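(* Let $\tau$ be a nonzero cardinal number, $p\in[1,\infty]$, and let $\varphi:\tau\to\tau$ be a map with $\sigma_\varphi(\ell^p(\tau))\subseteq\ell^p(\tau)$. (1) If $\psi:\ell^p(\tau)\to\ell^p(\tau)$ is a linear mapping such that $\sigma_\varphi\restriction_{\ell^p(\tau)}:\ell^p(\tau)\to\ell^p(\tau)$ is a $\psi$-derivation, then $\psi(\mathsf{w}^\beta)=\frac12\sigma_\varphi(\mathsf{w}^\beta)$ for all $\beta<\tau$. (2) If $\psi:\ell^p(\tau)\to\ell^p(\tau)$ is a continuous linear operator, then $\sigma_\varphi\restriction_{\ell^p(\tau)}:\ell^p(\tau)\to\ell^p(\tau)$ is a $\psi$-derivation if and only if $\psi=\frac12\sigma_\varphi\restriction_{\ell^p(\tau)}$.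
   Context: For a nonzero cardinal $\tau$ (regarded as the set of ordinals $\alpha<\tau$) and $p\in[1,\infty]$, $\ell^p(\tau)$ is the set of $x=(x_\alpha)_{\alpha<\tau}\in\mathbb{C}^\tau$ with $\|x\|_p<\infty$, where $\|x\|_p=(\sum_{\alpha<\tau}|x_\alpha|^p)^{1/p}$ for $p<\infty$ and $\|x\|_\infty=\sup_{\alpha<\tau}|x_\alpha|$. With the norm $\|\cdot\|_p$, pointwise sum and pointwise product it is a Banach algebra. For $\varphi:\tau\to\tau$, the generalized shift is $\sigma_\varphi:\mathbb{C}^\tau\to\mathbb{C}^\tau$, $(x_\alpha)_{\alpha<\tau}\mapsto(x_{\varphi(\alpha)})_{\alpha<\tau}$. For $\beta<\tau$, $\mathsf{w}^\beta\in\mathbb{C}^\tau$ is the element whose $\beta$-th coordinate is $1$ and whose other coordinates are $0$. For linear mappings $d,\psi:\mathcal{A}\to\mathcal{A}$ on a Banach algebra $\mathcal{A}$, $d$ is a $\psi$-derivation if $d(ab)=d(a)\psi(b)+\psi(a)d(b)$ for all $a,b\in\mathcal{A}$. *)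

theory Defs
  imports "HOL-Analysis.Analysis"
begin

text \<open>
  A cardinal is a minimal well-order \<open>\<tau>\<close> (\<open>Card_order \<tau>\<close>) as in the cardinals library of HOL.
  Its elements, i.e. the ordinals \<open>\<alpha> < \<tau>\<close>, are the members of \<open>Field \<tau>\<close>; finite cardinals are
  included. A family in \<open>\<complex>\<^sup>\<tau>\<close> is represented by the function that agrees with it on \<open>Field \<tau>\<close>
  and is 0 elsewhere, so that equality of families is equality of functions and the pointwise
  operations need no restriction.
\<close>

definition cfamilies :: "'i rel \<Rightarrow> ('i \<Rightarrow> complex) set" where
  "cfamilies \<tau> = {x. \<forall>\<alpha>. \<alpha> \<notin> Field \<tau> \<longrightarrow> x \<alpha> = 0}"

text \<open>The exponent \<open>p\<close> lives in \<open>[0,\<infinity>]\<close>; only \<open>1 \<le> p\<close> is of interest. The value may be \<open>\<infinity>\<close>: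
  sums and suprema are taken in \<^typ>\<open>ennreal\<close>, where they always exist.\<close>

definition lp_norm :: "ennreal \<Rightarrow> 'i rel \<Rightarrow> ('i \<Rightarrow> complex) \<Rightarrow> ennreal" where
  "lp_norm p \<tau> x =
     (if p = \<infinity> then (SUP \<alpha>\<in>Field \<tau>. ennreal (cmod (x \<alpha>)))
      else let S = (\<Sum>\<^sub>\<infinity>\<alpha>\<in>Field \<tau>. ennreal (cmod (x \<alpha>) powr enn2real p))
           in if S = \<infinity> then \<infinity> else ennreal (enn2real S powr (1 / enn2real p)))"

definition lp :: "ennreal \<Rightarrow> 'i rel \<Rightarrow> ('i \<Rightarrow> complex) set" where
  "lp p \<tau> = {x \<in> cfamilies \<tau>. lp_norm p \<tau> x < \<infinity>}"

definition lp_topology :: "ennreal \<Rightarrow> 'i rel \<Rightarrow> ('i \<Rightarrow> complex) topology" where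
  "lp_topology p \<tau> =
     Metric_space.mtopology (lp p \<tau>) (\<lambda>x y. enn2real (lp_norm p \<tau> (\<lambda>\<alpha>. x \<alpha> - y \<alpha>)))"

definition gen_shift :: "'i rel \<Rightarrow> ('i \<Rightarrow> 'i) \<Rightarrow> ('i \<Rightarrow> complex) \<Rightarrow> ('i \<Rightarrow> complex)" where
  "gen_shift \<tau> \<phi> x = (\<lambda>\<alpha>. if \<alpha> \<in> Field \<tau> then x (\<phi> \<alpha>) else 0)"

definition unit_family :: "'i \<Rightarrow> ('i \<Rightarrow> complex)" where
  "unit_family \<beta> = (\<lambda>\<alpha>. if \<alpha> = \<beta> then 1 else 0)"

text \<open>Complex-linear self-maps of a space \<open>A\<close> of complex families, given on \<open>A\<close> only.\<close>

definition linear_self_map :: "('i \<Rightarrow> complex) set \<Rightarrow> (('i \<Rightarrow> complex) \<Rightarrow> ('i \<Rightarrow> complex)) \<Rightarrow> bool" where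
  "linear_self_map A f \<longleftrightarrow>
     f \<in> A \<rightarrow> A \<and>
     (\<forall>x\<in>A. \<forall>y\<in>A. f (\<lambda>\<alpha>. x \<alpha> + y \<alpha>) = (\<lambda>\<alpha>. f x \<alpha> + f y \<alpha>)) \<and>
     (\<forall>c. \<forall>x\<in>A. f (\<lambda>\<alpha>. c * x \<alpha>) = (\<lambda>\<alpha>. c * f x \<alpha>))"

definition psi_derivation ::
  "('i \<Rightarrow> complex) set \<Rightarrow> (('i \<Rightarrow> complex) \<Rightarrow> ('i \<Rightarrow> complex))
    \<Rightarrow> (('i \<Rightarrow> complex) \<Rightarrow> ('i \<Rightarrow> complex)) \<Rightarrow> bool" where
  "psi_derivation A \<psi> d \<longleftrightarrow>
     linear_self_map A d \<and> linear_self_map A \<psi> \<and>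
     (\<forall>a\<in>A. \<forall>b\<in>A. d (\<lambda>\<alpha>. a \<alpha> * b \<alpha>) = (\<lambda>\<alpha>. d a \<alpha> * \<psi> b \<alpha> + \<psi> a \<alpha> * d b \<alpha>))"

end

theory Submission imports Defs begin

text \<open>
  Fix \<open>\<alpha>\<close> and put \<open>\<gamma> = \<phi> \<alpha>\<close>, so that the shift of \<open>w\<^sup>\<gamma>\<close> has \<open>\<alpha>\<close>-th coordinate 1. Since \<open>w\<^sup>\<gamma>\<close> is
  idempotent, the Leibniz rule forces the \<open>\<alpha>\<close>-th coordinate of \<open>\<psi> w\<^sup>\<gamma>\<close> to be \<open>1/2\<close>. Applied to
  \<open>a w\<^sup>\<gamma>\<close>, whose shift has \<open>\<alpha>\<close>-th coordinate \<open>a\<^sub>\<gamma>\<close>, the rule then gives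
  \<open>a\<^sub>\<gamma> = a\<^sub>\<gamma> / 2 + (\<psi> a)\<^sub>\<alpha>\<close>. This determines \<open>\<psi>\<close> on all of \<open>\<ell>\<^sup>p\<close> without any density argument.
\<close>

lemma unit_family_in_lp:
  assumes "\<beta> \<in> Field \<tau>"
  shows "unit_family \<beta> \<in> lp p \<tau>"
proof -
  \<comment> \<open>Since \<open>0 powr q = 0\<close> for every real \<open>q\<close>, even
    \<open>q = 0\<close>, all terms off \<open>\<beta>\<close> vanish whatever the exponent.\<close>
  have "(\<Sum>\<^sub>\<infinity>\<alpha>\<in>Field \<tau>. ennreal (cmod (unit_family \<beta> \<alpha>) powr q))
      = (\<Sum>\<^sub>\<infinity>\<alpha>\<in>{\<beta>}. ennreal (cmod (unit_family \<beta> \<alpha>) powr q))" for q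
    by (rule infsum_cong_neutral) (use assms in \<open>auto simp: unit_family_def\<close>)
  then have sum: "(\<Sum>\<^sub>\<infinity>\<alpha>\<in>Field \<tau>. ennreal (cmod (unit_family \<beta> \<alpha>) powr q)) = 1" for q
    by (simp add: unit_family_def)
  have "(SUP \<alpha>\<in>Field \<tau>. ennreal (cmod (unit_family \<beta> \<alpha>))) \<le> 1"
    by (rule SUP_least) (auto simp: unit_family_def)
  also have "1 < (\<infinity>::ennreal)"
    by simp
  finally have "lp_norm p \<tau> (unit_family \<beta>) < \<infinity>"
    by (auto simp: lp_norm_def sum Let_def)
  then show ?thesis
    using assms by (auto simp: lp_def cfamilies_def unit_family_def)
qed

text \<open>The argument is purely algebraic and tests only against unit families, so stating it for
  a general \<open>A\<close> covers all exponents at once.\<close>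

lemma psi_derivation_gen_shift_imp_half:
  assumes "\<phi> \<in> Field \<tau> \<rightarrow> Field \<tau>"
    and A: "A \<subseteq> cfamilies \<tau>" "\<And>\<beta>. \<beta> \<in> Field \<tau> \<Longrightarrow> unit_family \<beta> \<in> A"
    and \<psi>: "psi_derivation A \<psi> (gen_shift \<tau> \<phi>)"
    and a: "a \<in> A"
  shows "\<psi> a = (\<lambda>\<alpha>. 1 / 2 * gen_shift \<tau> \<phi> a \<alpha>)"
proof
  fix \<alpha>
  show "\<psi> a \<alpha> = 1 / 2 * gen_shift \<tau> \<phi> a \<alpha>"
  proof (cases "\<alpha> \<in> Field \<tau>")
    \<comment> \<open>Off the index set both sides are 0: the left because \<open>\<psi>\<close>
      maps \<open>A\<close> into \<open>A\<close>, the right by the default value of the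
      shift.\<close>
    case False
    have "\<psi> a \<in> cfamilies \<tau>"
      using \<psi> a A(1) unfolding psi_derivation_def linear_self_map_def by blast
    with False show ?thesis
      by (simp add: cfamilies_def gen_shift_def)
  next
    case True
    let ?w = "unit_family (\<phi> \<alpha>)"
    have w: "?w \<in> A"
      using True assms(1) A(2) by blast
    have shift_w: "gen_shift \<tau> \<phi> ?w \<alpha> = 1"
      using True by (simp add: gen_shift_def unit_family_def)
    \<comment> \<open>Used twice: \<open>x = ?w\<close> fixes the coefficient
      \<open>\<psi> ?w \<alpha>\<close>, then \<open>x = a\<close> yields
      \<open>\<psi> a \<alpha>\<close>.\<close>
    have leibniz: "gen_shift \<tau> \<phi> x \<alpha> = gen_shift \<tau> \<phi> x \<alpha> * \<psi> ?w \<alpha> + \<psi> x \<alpha>" if "x \<in> A" for x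
    proof -
      have "gen_shift \<tau> \<phi> (\<lambda>\<alpha>. x \<alpha> * ?w \<alpha>) \<alpha>
          = gen_shift \<tau> \<phi> x \<alpha> * \<psi> ?w \<alpha> + \<psi> x \<alpha> * gen_shift \<tau> \<phi> ?w \<alpha>"
        using \<psi> that w unfolding psi_derivation_def by metis
      moreover have "gen_shift \<tau> \<phi> (\<lambda>\<alpha>. x \<alpha> * ?w \<alpha>) \<alpha> = gen_shift \<tau> \<phi> x \<alpha>"
        using True by (simp add: gen_shift_def unit_family_def)
      ultimately show ?thesis
        using shift_w by simp
    qed
    from leibniz[OF w] shift_w have "2 * \<psi> ?w \<alpha> = 1"
      by simp
    then have "\<psi> ?w \<alpha> = 1 / 2"
      by (simp add: eq_divide_eq mult.commute)
    with leibniz[OF a] show ?thesis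
      by (simp add: field_simps)
  qed
qed

lemma linear_self_map_gen_shift:
  assumes "gen_shift \<tau> \<phi> ` A \<subseteq> A"
  shows "linear_self_map A (gen_shift \<tau> \<phi>)"
  using assms by (auto simp: linear_self_map_def gen_shift_def)

text \<open>The shift is multiplicative, so each of the two Leibniz summands is half the shift of
  the product.\<close>

lemma half_imp_psi_derivation_gen_shift:
  assumes "gen_shift \<tau> \<phi> ` A \<subseteq> A"
    and "linear_self_map A \<psi>"
    and "\<forall>x\<in>A. \<psi> x = (\<lambda>\<alpha>. 1 / 2 * gen_shift \<tau> \<phi> x \<alpha>)"
  shows "psi_derivation A \<psi> (gen_shift \<tau> \<phi>)"
  unfolding psi_derivation_def
  using assms(2,3) linear_self_map_gen_shift[OF assms(1)]
  by (auto simp: gen_shift_def)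

theorem corollary2p3:
  fixes \<tau> :: "'i rel" and p :: ennreal and \<phi> :: "'i \<Rightarrow> 'i"
  assumes "Card_order \<tau>" and "Field \<tau> \<noteq> {}"
    and "1 \<le> p"
    and "\<phi> \<in> Field \<tau> \<rightarrow> Field \<tau>"
    and "gen_shift \<tau> \<phi> ` lp p \<tau> \<subseteq> lp p \<tau>"
  shows "(\<forall>\<psi>. linear_self_map (lp p \<tau>) \<psi> \<longrightarrow>
            psi_derivation (lp p \<tau>) \<psi> (gen_shift \<tau> \<phi>) \<longrightarrow>
            (\<forall>\<beta>\<in>Field \<tau>. \<psi> (unit_family \<beta>)
               = (\<lambda>\<alpha>. 1 / 2 * gen_shift \<tau> \<phi> (unit_family \<beta>) \<alpha>)))
       \<and> (\<forall>\<psi>. linear_self_map (lp p \<tau>) \<psi> \<longrightarrow>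
            continuous_map (lp_topology p \<tau>) (lp_topology p \<tau>) \<psi> \<longrightarrow>
            (psi_derivation (lp p \<tau>) \<psi> (gen_shift \<tau> \<phi>) \<longleftrightarrow>
             (\<forall>x\<in>lp p \<tau>. \<psi> x = (\<lambda>\<alpha>. 1 / 2 * gen_shift \<tau> \<phi> x \<alpha>))))"
proof -
  have "lp p \<tau> \<subseteq> cfamilies \<tau>"
    by (auto simp: lp_def)
  \<comment> \<open>Both the claim on unit families and the forward direction of the equivalence are
    instances of this formula.\<close>
  note half = psi_derivation_gen_shift_imp_half[OF assms(4) this unit_family_in_lp]
  show ?thesis
  proof (intro conjI allI impI ballI iffI)
    fix \<psi> \<beta>
    assume "psi_derivation (lp p \<tau>) \<psi> (gen_shift \<tau> \<phi>)" "\<beta> \<in> Field \<tau>"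
    then show "\<psi> (unit_family \<beta>) = (\<lambda>\<alpha>. 1 / 2 * gen_shift \<tau> \<phi> (unit_family \<beta>) \<alpha>)"
      by (intro half unit_family_in_lp)
  next
    fix \<psi> x
    assume "psi_derivation (lp p \<tau>) \<psi> (gen_shift \<tau> \<phi>)" "x \<in> lp p \<tau>"
    then show "\<psi> x = (\<lambda>\<alpha>. 1 / 2 * gen_shift \<tau> \<phi> x \<alpha>)"
      by (rule half[rotated])
  next
    fix \<psi>
    assume "linear_self_map (lp p \<tau>) \<psi>"
      and "\<forall>x\<in>lp p \<tau>. \<psi> x = (\<lambda>\<alpha>. 1 / 2 * gen_shift \<tau> \<phi> x \<alpha>)"
    then show "psi_derivation (lp p \<tau>) \<psi> (gen_shift \<tau> \<phi>)"
      by (rule half_imp_psi_derivation_gen_shift[OF assms(5)])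
  qed
qed

end
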